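(* Let $s\ge 2$ and $t$ be integers with $1\le t\le s-2$. Then the functions $\mathcal{F}_{s,t,r,n}$, where $r$ ranges over the integers distinguished with respect to $(s,t)$ and $n$ ranges over $\Upsilon_{s,t,r}$, span the complex vector space of all rational functions (with complex coefficients) that are fixed by $\phi_{s,t}$.
   Context: For integers $s,t$, $\phi_{s,t}$ maps a formal series $\sum_{n\in\mathbb{Z}}a_nx^n$ with complex coefficients to $\sum_{n\in\mathbb{Z}}a_{sn+t}x^n$. A rational function $R\in\mathbb{C}(x)$ is identified with its Laurent expansion at $x=0$, $\sum_{n\gg-\infty}a_nx^n$ (coefficients vanish for sufficiently negative $n$); $R$ is fixed by $\phi_{s,t}$ if $\phi_{s,t}(R)=R$ as formal series. For integers $r\ge1$ with $\gcd(r,s)=1$, $\operatorname{ord}_r(s)$ is the least positive $m$ with $s^m\equiv1\pmod r$; an integer $r\ge 2$ is distinguished with respect to $(s,t)$ if $\gcd(r,s)=1$ and $r$ divides $t\cdot\frac{s^{\operatorname{ord}_r(s)}-1}{s-1}$. For such $r$, let $\rho_{s,t}:\mathbb{Z}/r\mathbb{Z}\to\mathbb{Z}/r\mathbb{Z}$, $n\mapsto sn+t \bmod r$ (a bijection), and for $n\in\{0,\dots,r-1\}$ let $F_{s,t,r,n}=\{\rho_{s,t}^{(i)}(n)\bmod r : i\in\mathbb{Z}\}$, viewed as a subset of $\{0,\dots,r-1\}$, where $\rho^{(i)}$ is the $i$-th iterate. Let $\Upsilon_{s,t,r}\subseteq\{0,\dots,r-1\}$ be a complete set of representatives of these orbits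 (for each $n$ there is a unique $n'\in\Upsilon_{s,t,r}$ with $F_{s,t,r,n}=F_{s,t,r,n'}$). Define $\mathcal{F}_{s,t,r,n}(x)=\frac{1}{1-x^r}\sum_{j\in F_{s,t,r,n}}x^j$. *)

theory Defs
  imports
    "HOL-Computational_Algebra.Computational_Algebra"
    "HOL-Computational_Algebra.Field_as_Ring"
    "HOL-Number_Theory.Number_Theory"
begin

type_synonym ratfun = "complex poly fract"

abbreviation poly_to_fls :: "complex poly \<Rightarrow> complex fls" where
  "poly_to_fls p \<equiv> fps_to_fls (fps_of_poly p)"

text \<open>Laurent expansion at \<open>0\<close>; any representing fraction gives the same series.\<close>
definition laurent :: "ratfun \<Rightarrow> complex fls" where
  "laurent R = poly_to_fls (fst (quot_of_fract R)) / poly_to_fls (snd (quot_of_fract R))"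

lemma laurent_Fract:
  assumes "q \<noteq> 0"
  shows "laurent (Fract p q) = poly_to_fls p / poly_to_fls q"
proof -
  define x where "x = quot_of_fract (Fract p q)"
  have nz: "snd x \<noteq> 0" by (simp add: x_def)
  have "Fract (fst x) (snd x) = Fract p q"
    by (simp add: x_def Fract_quot_of_fract)
  then have eq: "fst x * q = p * snd x"
    using assms nz by (simp add: eq_fract)
  have "poly_to_fls (fst x) * poly_to_fls q = poly_to_fls p * poly_to_fls (snd x)"
    using eq by (metis fls_times_fps_to_fls fps_of_poly_mult)
  moreover have "poly_to_fls (snd x) \<noteq> 0" "poly_to_fls q \<noteq> 0"
    using nz assms by auto
  ultimately show ?thesis
    by (simp add: laurent_def frac_eq_eq flip: x_def)
qed

definition scale_ratfun :: "complex \<Rightarrow> ratfun \<Rightarrow> ratfun" where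
  "scale_ratfun c R = to_fract [:c:] * R"

interpretation ratfun: vector_space scale_ratfun
proof
  fix a b :: complex and x y :: ratfun
  show "scale_ratfun a (x + y) = scale_ratfun a x + scale_ratfun a y"
    by (simp add: scale_ratfun_def distrib_left)
  have "to_fract [:a + b:] = to_fract [:a:] + to_fract [:b:]"
    by (simp flip: to_fract_add)
  then show "scale_ratfun (a + b) x = scale_ratfun a x + scale_ratfun b x"
    by (simp add: scale_ratfun_def distrib_right)
  have "to_fract [:a * b:] = to_fract [:a:] * to_fract [:b:]"
    by (simp flip: to_fract_mult)
  then show "scale_ratfun a (scale_ratfun b x) = scale_ratfun (a * b) x"
    by (simp add: scale_ratfun_def mult.assoc)
  show "scale_ratfun 1 x = x"
    by (simp add: scale_ratfun_def flip: one_pCons)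
qed

definition phi :: "int \<Rightarrow> int \<Rightarrow> (int \<Rightarrow> complex) \<Rightarrow> (int \<Rightarrow> complex)" where
  "phi s t a = (\<lambda>n. a (s * n + t))"

definition fixed_by_phi :: "int \<Rightarrow> int \<Rightarrow> ratfun \<Rightarrow> bool" where
  "fixed_by_phi s t R \<longleftrightarrow> phi s t (fls_nth (laurent R)) = fls_nth (laurent R)"

text \<open>The division by \<open>s - 1\<close> is exact for \<open>s \<noteq> 1\<close>; \<open>s = 1\<close> gives \<open>0 div 0 = 0\<close>.\<close>
definition distinguished :: "int \<Rightarrow> int \<Rightarrow> int \<Rightarrow> bool" where
  "distinguished s t r \<longleftrightarrow> r \<ge> 2 \<and> coprime r s \<and> r dvd t * ((s ^ ord r s - 1) div (s - 1))"

text \<open>Residue classes modulo \<open>r\<close> are represented by \<open>{0..<r}\<close>.\<close>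
definition rho :: "int \<Rightarrow> int \<Rightarrow> int \<Rightarrow> int \<Rightarrow> int" where
  "rho s t r n = (s * n + t) mod r"

lemma bij_betw_rho:
  assumes "r \<ge> 1" "coprime r s"
  shows "bij_betw (rho s t r) {0..<r} {0..<r}"
proof -
  have "inj_on (rho s t r) {0..<r}"
  proof (rule inj_onI)
    fix x y assume xy: "x \<in> {0..<r}" "y \<in> {0..<r}" "rho s t r x = rho s t r y"
    then have "[s * x + t = s * y + t] (mod r)" by (simp add: rho_def cong_def)
    then have "[s * x = s * y] (mod r)" by (simp add: cong_add_rcancel)
    then have "[x = y] (mod r)" using assms by (simp add: cong_mult_lcancel coprime_commute)
    then show "x = y" using xy by (simp add: cong_def)
  qed
  moreover have "rho s t r ` {0..<r} \<subseteq> {0..<r}"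
    using assms by (auto simp: rho_def)
  ultimately show ?thesis
    by (simp add: bij_betw_def endo_inj_surj)
qed

definition rho_iter :: "int \<Rightarrow> int \<Rightarrow> int \<Rightarrow> int \<Rightarrow> int \<Rightarrow> int" where
  "rho_iter s t r i =
     (if i \<ge> 0 then rho s t r ^^ nat i else inv_into {0..<r} (rho s t r) ^^ nat (- i))"

definition orbit_set :: "int \<Rightarrow> int \<Rightarrow> int \<Rightarrow> int \<Rightarrow> int set" where
  "orbit_set s t r n = {rho_iter s t r i n | i. True}"

definition orbit_reps :: "int \<Rightarrow> int \<Rightarrow> int \<Rightarrow> int set \<Rightarrow> bool" where
  "orbit_reps s t r U \<longleftrightarrow> U \<subseteq> {0..<r} \<and>
     (\<forall>n\<in>{0..<r}. \<exists>!n'. n' \<in> U \<and> orbit_set s t r n = orbit_set s t r n')"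

definition orbit_fun :: "int \<Rightarrow> int \<Rightarrow> int \<Rightarrow> int \<Rightarrow> ratfun" where
  "orbit_fun s t r n =
     Fract (\<Sum>j\<in>orbit_set s t r n. Polynomial.monom 1 (nat j)) (1 - Polynomial.monom 1 (nat r))"

end

theory Submission
  imports Defs "HOL-Combinatorics.Cycles" "HOL-Combinatorics.Orbits"
begin

text \<open>
  Let \<open>R = \<Sum> a\<^sub>n x\<^sup>n\<close> be fixed. The map \<open>n \<mapsto> s n + t\<close> drives every negative \<open>n\<close> to \<open>-\<infinity>\<close>, so
  \<open>a\<^sub>n = 0\<close> for \<open>n < 0\<close>, and \<open>R = P / Q\<close> in lowest terms with \<open>Q(0) \<noteq> 0\<close>. Since extracting the
  coefficients of index \<open>s n + t\<close> from \<open>G(x\<^sup>s) R\<close> gives \<open>G R\<close>, any \<open>G\<close> with \<open>Q dvd G(x\<^sup>s)\<close> satisfies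
  \<open>Q dvd G\<close>; taking for \<open>G\<close> a power of the product of \<open>x - z\<^sup>s\<close> over the roots \<open>z\<close> of \<open>Q\<close> shows that
  every root is the \<open>s\<close>-th power of a root. Hence \<open>z \<mapsto> z\<^sup>s\<close> permutes the finite set of roots, and
  all of them are roots of unity of order dividing \<open>r = 1 + s + \<dots> + s\<^bsup>k-1\<^esup>\<close> for a suitable \<open>k\<close>.
  On each class modulo \<open>r\<close> the coefficients are therefore eventually polynomial in \<open>n\<close>; since the
  \<open>k\<close>-th iterate of \<open>n \<mapsto> s n + t\<close> increases \<open>n\<close> and preserves its class, each value is taken
  infinitely often, so these polynomials are constant and \<open>a\<close> is \<open>r\<close>-periodic on the naturals. As
  \<open>s\<close> has order \<open>k\<close> modulo \<open>r\<close>, this \<open>r\<close> is distinguished, and \<open>a\<close> is constant on the orbits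
  modulo \<open>r\<close>.
\<close>

subsection \<open>Iteration of maps\<close>

lemma finite_bij_betw_funpow_eq_self:
  assumes "finite A" "bij_betw f A A"
  obtains m where "m > 0" "\<And>x. x \<in> A \<Longrightarrow> (f ^^ m) x = x"
proof -
  have "restrict_id f A permutes A"
    using assms(2) by (intro bij_imp_permutes bij_betw_restrict_id) auto
  then have "permutation (restrict_id f A)"
    using assms(1) permutation_permutes by blast
  then obtain m where m: "restrict_id f A ^^ m = id" "m > 0"
    by (rule permutation_is_nilpotent)
  have "(f ^^ k) x = (restrict_id f A ^^ k) x \<and> (f ^^ k) x \<in> A" if "x \<in> A" for k x
    using that assms(2) by (induction k) (auto simp: bij_betw_def)
  then show ?thesis using that m by simp
qed

lemma inv_into_funpow_in_orbit:
  assumes "finite A" and bij: "bij_betw f A A" and "x \<in> A"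
  shows "(inv_into A f ^^ k) x \<in> orbit f x"
proof -
  obtain m where m: "m > 0" "\<And>y. y \<in> A \<Longrightarrow> (f ^^ m) y = y"
    using finite_bij_betw_funpow_eq_self[OF assms(1,2)] by blast
  then have self: "y \<in> orbit f y" if "y \<in> A" for y
    using m(1) m(2)[OF that, symmetric] unfolding orbit_altdef by blast
  have inv: "inv_into A f y \<in> A" "f (inv_into A f y) = y" if "y \<in> A" for y
    using that bij by (auto simp: bij_betw_def inv_into_into f_inv_into_f)
  have inv_in_orbit: "inv_into A f y \<in> orbit f y" if "y \<in> A" for y
    using self_in_orbit_step[OF self] self inv[OF that] by metis
  have "(inv_into A f ^^ k) x \<in> A \<and> (inv_into A f ^^ k) x \<in> orbit f x"
  proof (induction k)
    case 0
    then show ?case using self \<open>x \<in> A\<close> by simp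
  next
    case (Suc k)
    then show ?case using inv inv_in_orbit orbit_trans by fastforce
  qed
  then show ?thesis by simp
qed

lemma funpow_affine:
  "((\<lambda>n. s * n + t) ^^ k) n = s ^ k * n + t * (\<Sum>i<k. s ^ i)" for s :: "'a :: comm_semiring_1"
proof (induction k)
  case (Suc k)
  have "(\<Sum>i<Suc k. s ^ i) = s * (\<Sum>i<k. s ^ i) + 1"
    by (simp add: sum.lessThan_Suc_shift sum_distrib_left add.commute del: sum.lessThan_Suc)
  then show ?case by (simp only: funpow.simps o_apply Suc.IH) (simp add: algebra_simps)
qed simp

lemma invariant_funpow:
  assumes "\<And>x. g (f x) = g x"
  shows "g ((f ^^ k) x) = g x"
  by (induction k) (simp_all add: assms)

lemma nat_periodic_mod:
  fixes f :: "nat \<Rightarrow> 'a"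
  assumes "\<And>n. f (n + r) = f n"
  shows "f (n mod r) = f n"
proof -
  have "f (m + k * r) = f m" for m k
    by (induction k) (simp_all add: assms add.assoc[symmetric] add.commute[of r])
  from this[of "n mod r" "n div r"] show ?thesis by simp
qed

subsection \<open>Geometric sums\<close>

lemma power_diff_1_eq_nat: "s ^ k - 1 = (s - 1) * (\<Sum>i<k. s ^ i)" for s :: nat
proof (cases "s = 0")
  case False
  then have "int (s ^ k - 1) = int ((s - 1) * (\<Sum>i<k. s ^ i))"
    using power_diff_1_eq[of "int s" k] by (simp add: of_nat_diff)
  then show ?thesis by (simp only: of_nat_eq_iff)
qed (cases k, simp_all)

lemma ex_dvd_geometric_sum:
  fixes d s :: nat
  assumes "coprime d s" "d > 0" "s \<ge> 2"
  shows "\<exists>k\<ge>b. d dvd (\<Sum>i<k. s ^ i)"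
proof -
  define e where "e = totient (d * (s - 1))"
  have "e > 0" using assms by (simp add: e_def)
  have "coprime s (s - 1)"
    using assms by (metis One_nat_def Suc_diff_1 coprime_Suc_left_nat less_le_trans pos2)
  then have "[s ^ e = 1] (mod d * (s - 1))"
    unfolding e_def using assms by (intro euler_theorem) (simp add: coprime_commute)
  then have "[(s ^ e) ^ b = 1 ^ b] (mod d * (s - 1))" by (rule cong_pow)
  then have "d * (s - 1) dvd s ^ (e * b) - 1"
    unfolding power_mult power_one by (rule cong_to_1_nat)
  then have "d dvd (\<Sum>i<e * b. s ^ i)"
    using assms(3) unfolding power_diff_1_eq_nat by (simp add: mult.commute[of d])
  moreover have "e * b \<ge> b" using \<open>e > 0\<close> by simp
  ultimately show ?thesis by blast
qed

lemma coprime_geometric_sum: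
  fixes s :: int
  assumes "k > 0"
  shows "coprime (\<Sum>i<k. s ^ i) s"
proof -
  obtain l where "k = Suc l" using assms by (cases k) auto
  then have "(\<Sum>i<k. s ^ i) = s * (\<Sum>i<l. s ^ i) + 1"
    by (simp add: sum.lessThan_Suc_shift sum_distrib_left del: sum.lessThan_Suc)
  then show ?thesis by (intro coprimeI) (simp add: dvd_add_right_iff)
qed

lemma ord_geometric_sum:
  fixes s :: int
  assumes "s \<ge> 2" "k > 0"
  shows "ord (\<Sum>i<k. s ^ i) s = k"
proof -
  define r where "r = (\<Sum>i<k. s ^ i)"
  have "ord r s = (LEAST d. d > 0 \<and> [s ^ d = 1] (mod r))"
    using coprime_geometric_sum[OF assms(2)] by (simp add: ord_def r_def)
  also have "\<dots> = k"
  proof (rule Least_equality)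
    show "k > 0 \<and> [s ^ k = 1] (mod r)"
      using assms(2) by (simp add: cong_iff_dvd_diff power_diff_1_eq r_def)
  next
    fix d assume d: "d > 0 \<and> [s ^ d = 1] (mod r)"
    have "s ^ d - 1 > 0" using d assms(1) by (simp add: one_less_power)
    moreover have "r dvd s ^ d - 1" using d by (simp add: cong_iff_dvd_diff)
    ultimately have "r \<le> s ^ d - 1" by (intro zdvd_imp_le)
    moreover have "s ^ d \<le> r" if "d < k"
      unfolding r_def using assms(1) that by (intro member_le_sum) auto
    ultimately show "k \<le> d" by force
  qed
  finally show ?thesis by (simp add: r_def)
qed

lemma distinguished_geometric_sum:
  assumes "s \<ge> 2" "k \<ge> 2"
  shows "distinguished s t (\<Sum>i<k. s ^ i)"
proof -
  have "(\<Sum>i<2. s ^ i) \<le> (\<Sum>i<k. s ^ i)"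
    using assms by (intro sum_mono2) auto
  then have "(\<Sum>i<k. s ^ i) \<ge> 2" using assms(1) by (simp add: numeral_2_eq_2)
  moreover have "(s ^ k - 1) div (s - 1) = (\<Sum>i<k. s ^ i)"
    using assms(1) by (simp add: power_diff_1_eq)
  ultimately show ?thesis
    using assms by (simp add: distinguished_def coprime_geometric_sum ord_geometric_sum)
qed

subsection \<open>Eventually polynomial sequences\<close>

lemma ex_poly_antidifference_power:
  "\<exists>q :: 'a :: field_char_0 poly. \<forall>x. poly q (x + 1) - poly q x = x ^ n"
proof (induction n rule: less_induct)
  case (less n)
  then obtain q :: "nat \<Rightarrow> 'a poly"
    where q: "\<And>k x. k < n \<Longrightarrow> poly (q k) (x + 1) - poly (q k) x = x ^ k"
    by metis
  define p where "p =
    Polynomial.monom 1 (Suc n) - (\<Sum>k<n. Polynomial.smult (of_nat (Suc n choose k)) (q k))"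
  let ?q = "Polynomial.smult (1 / of_nat (Suc n)) p"
  have "poly p (x + 1) - poly p x = of_nat (Suc n) * x ^ n" for x
  proof -
    have "(x + 1) ^ Suc n - x ^ Suc n =
        of_nat (Suc n) * x ^ n + (\<Sum>k<n. of_nat (Suc n choose k) * x ^ k)"
      unfolding binomial_ring[of x 1]
      by (simp add: lessThan_Suc_atMost[symmetric] del: binomial_Suc_Suc)
    also have "(\<Sum>k<n. of_nat (Suc n choose k) * x ^ k) =
        (\<Sum>k<n. of_nat (Suc n choose k) * (poly (q k) (x + 1) - poly (q k) x))"
      using q by simp
    finally show ?thesis
      by (simp add: p_def poly_monom poly_sum right_diff_distrib sum_subtractf algebra_simps
          del: power_Suc binomial_Suc_Suc of_nat_Suc)
  qed
  then have "poly ?q (x + 1) - poly ?q x = x ^ n" for x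
    by (simp flip: right_diff_distrib diff_divide_distrib del: of_nat_Suc)
  then show ?case by blast
qed

lemma ex_poly_antidifference:
  fixes p :: "'a :: field_char_0 poly"
  shows "\<exists>q. \<forall>x. poly q (x + 1) - poly q x = poly p x"
proof -
  obtain q :: "nat \<Rightarrow> 'a poly" where q: "\<And>n x. poly (q n) (x + 1) - poly (q n) x = x ^ n"
    using ex_poly_antidifference_power by metis
  let ?q = "\<Sum>i\<le>Polynomial.degree p. Polynomial.smult (Polynomial.coeff p i) (q i)"
  have "poly ?q (x + 1) - poly ?q x = poly p x" for x
    by (simp add: poly_sum poly_altdef[of p] q flip: sum_subtractf right_diff_distrib)
  then show ?thesis by blast
qed

definition eventually_polynomial :: "(nat \<Rightarrow> 'a :: comm_semiring_1) \<Rightarrow> bool" where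
  "eventually_polynomial b \<longleftrightarrow> (\<exists>p. \<forall>\<^sub>F n in sequentially. b n = poly p (of_nat n))"

lemma eventually_polynomial_if_difference:
  fixes b :: "nat \<Rightarrow> 'a :: field_char_0"
  assumes "eventually_polynomial (\<lambda>n. b (Suc n) - b n)"
  shows "eventually_polynomial b"
proof -
  obtain p N where p: "\<And>n. n \<ge> N \<Longrightarrow> b (Suc n) - b n = poly p (of_nat n)"
    using assms unfolding eventually_polynomial_def eventually_sequentially by blast
  obtain q where q: "\<And>x. poly q (x + 1) - poly q x = poly p x"
    using ex_poly_antidifference by blast
  define c where "c = b N - poly q (of_nat N)"
  have "b n - poly q (of_nat n) = c" if "n \<ge> N" for n
    using that
  proof (induction n rule: dec_induct)
    case (step n)
    have "b (Suc n) - b n = poly q (of_nat (Suc n)) - poly q (of_nat n)"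
      using p[OF step.hyps(1)] q[of "of_nat n"] by (simp add: add.commute)
    then show ?case using step.IH by (simp only: diff_eq_eq) (simp add: algebra_simps)
  qed (simp add: c_def)
  then have "\<forall>n\<ge>N. b n = poly (q + [:c:]) (of_nat n)"
    by (simp add: diff_eq_eq add.commute)
  then show ?thesis unfolding eventually_polynomial_def eventually_sequentially by blast
qed

lemma eventually_polynomial_imp_eventually_const:
  fixes b :: "nat \<Rightarrow> 'a :: field_char_0"
  assumes "eventually_polynomial b" and "\<exists>\<^sub>F n in sequentially. b n = c"
  shows "\<forall>\<^sub>F n in sequentially. b n = c"
proof -
  obtain p where p: "\<forall>\<^sub>F n in sequentially. b n = poly p (of_nat n)"
    using assms(1) by (auto simp: eventually_polynomial_def)
  have "\<exists>\<^sub>F n in sequentially. poly (p - [:c:]) (of_nat n) = 0"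
    using frequently_eventually_conj[OF assms(2) p] by (rule frequently_elim1) auto
  then have "infinite (of_nat -` {x. poly (p - [:c:]) x = 0} :: nat set)"
    by (simp add: cofinite_eq_sequentially[symmetric] frequently_cofinite vimage_def)
  then have "infinite {x. poly (p - [:c:]) x = 0}"
    using finite_vimageI inj_of_nat by blast
  then have "p = [:c:]" using poly_roots_finite[of "p - [:c:]"] by auto
  then show ?thesis using p by simp
qed

lemma rational_fps_eventually_polynomial:
  fixes F :: "'a :: field_char_0 fps"
  assumes "F * (1 - fps_X ^ r) ^ k = fps_of_poly p" "r > 0"
  shows "eventually_polynomial (\<lambda>j. fps_nth F (i + j * r))"
  using assms(1)
proof (induction k arbitrary: F)
  case 0
  have "Polynomial.coeff p (i + j * r) = 0" if "j > Polynomial.degree p" for j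
    using that assms(2) by (intro coeff_eq_0) (simp add: less_le_trans trans_le_add2)
  then have "\<forall>\<^sub>F j in sequentially. fps_nth F (i + j * r) = poly 0 (of_nat j)"
    using 0 by (auto intro!: eventually_sequentiallyI[of "Suc (Polynomial.degree p)"])
  then show ?case unfolding eventually_polynomial_def by blast
next
  case (Suc k)
  let ?D = "F * (1 - fps_X ^ r)"
  have "eventually_polynomial (\<lambda>j. fps_nth ?D (i + j * r))"
    using Suc.prems by (intro Suc.IH) (simp add: mult.assoc)
  then obtain q where "\<forall>\<^sub>F j in sequentially. fps_nth ?D (i + j * r) = poly q (of_nat j)"
    by (auto simp: eventually_polynomial_def)
  then have "\<forall>\<^sub>F j in sequentially. fps_nth ?D (i + Suc j * r) = poly q (of_nat (Suc j))"
    by (subst eventually_sequentially_Suc)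
  moreover have "fps_nth ?D (i + Suc j * r) = fps_nth F (i + Suc j * r) - fps_nth F (i + j * r)"
    for j by (simp add: right_diff_distrib fps_X_power_mult_right_nth)
  ultimately have "\<forall>\<^sub>F j in sequentially. fps_nth F (i + Suc j * r) - fps_nth F (i + j * r) =
      poly (q \<circ>\<^sub>p [:1, 1:]) (of_nat j)"
    by (simp add: poly_pcompose add.commute)
  then have "eventually_polynomial (\<lambda>j. fps_nth F (i + Suc j * r) - fps_nth F (i + j * r))"
    unfolding eventually_polynomial_def by blast
  then show ?case by (rule eventually_polynomial_if_difference)
qed

lemma recurrent_imp_frequently:
  fixes f :: "nat \<Rightarrow> 'a"
  assumes "\<And>n. \<exists>h>0. f (n + h * r) = f n"
  shows "\<exists>\<^sub>F h in sequentially. f (n + h * r) = f n"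
  unfolding frequently_sequentially
proof
  fix k show "\<exists>h\<ge>k. f (n + h * r) = f n"
  proof (induction k)
    case 0
    show ?case by (auto intro: exI[of _ 0])
  next
    case (Suc k)
    then obtain h where h: "h \<ge> k" "f (n + h * r) = f n" by blast
    obtain e where e: "e > 0" "f (n + h * r + e * r) = f (n + h * r)" using assms by blast
    have "f (n + (h + e) * r) = f n" using h e by (simp add: distrib_right add.assoc)
    moreover have "h + e \<ge> Suc k" using h e by simp
    ultimately show ?case by blast
  qed
qed

lemma rational_fps_periodic_if_recurrent:
  fixes F :: "'a :: field_char_0 fps"
  assumes rational: "F * (1 - fps_X ^ r) ^ k = fps_of_poly p" and "r > 0"
    and recurrent: "\<And>n. \<exists>h>0. fps_nth F (n + h * r) = fps_nth F n"
  shows "fps_nth F (n + r) = fps_nth F n"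
proof -
  have const: "\<forall>\<^sub>F h in sequentially. fps_nth F (m + h * r) = fps_nth F m" for m
    using rational_fps_eventually_polynomial[OF rational \<open>r > 0\<close>] recurrent_imp_frequently[OF recurrent]
    by (rule eventually_polynomial_imp_eventually_const)
  have "\<forall>\<^sub>F h in sequentially. fps_nth F (n + Suc h * r) = fps_nth F n"
    using const by (subst eventually_sequentially_Suc)
  with const[of "n + r"] have "\<forall>\<^sub>F h in sequentially. fps_nth F (n + r) = fps_nth F n"
    by eventually_elim (simp add: add.assoc)
  then show ?thesis by simp
qed

subsection \<open>Rational power series fixed by a section operator\<close>

definition section_fps :: "nat \<Rightarrow> nat \<Rightarrow> 'a fps \<Rightarrow> 'a fps" where
  "section_fps s t F = Abs_fps (\<lambda>n. fps_nth F (s * n + t))"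

lemma section_fps_nth [simp]: "fps_nth (section_fps s t F) n = fps_nth F (s * n + t)"
  by (simp add: section_fps_def)

lemma section_fps_mult_compose_X_power:
  fixes F G :: "'a :: comm_ring_1 fps"
  assumes "t < s"
  shows "section_fps s t ((G oo fps_X ^ s) * F) = G * section_fps s t F"
proof (rule fps_ext)
  fix n
  have "s > 0" using assms by simp
  let ?f = "\<lambda>i. fps_nth (G oo fps_X ^ s) i * fps_nth F (s * n + t - i)"
  have "i \<in> (\<lambda>i. s * i) ` {0..n}" if "i \<le> s * n + t" "s dvd i" for i
  proof -
    obtain k where k: "i = s * k" using \<open>s dvd i\<close> by blast
    then have "s * k < s * Suc n" using \<open>i \<le> s * n + t\<close> assms by simp
    then have "k \<le> n" by (simp only: mult_less_cancel1 less_Suc_eq_le)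
    then show ?thesis by (auto simp: k)
  qed
  then have "sum ?f {0..s * n + t} = sum ?f ((\<lambda>i. s * i) ` {0..n})"
    by (intro sum.mono_neutral_right) (auto simp: fps_nth_compose_X_power trans_le_add1)
  also have "\<dots> = (\<Sum>i=0..n. fps_nth G i * fps_nth F (s * (n - i) + t))"
    using \<open>s > 0\<close>
    by (simp add: sum.reindex inj_on_def fps_nth_compose_X_power diff_mult_distrib2)
  finally show "fps_nth (section_fps s t ((G oo fps_X ^ s) * F)) n =
      fps_nth (G * section_fps s t F) n"
    by (simp add: fps_mult_nth)
qed

lemma section_fps_of_poly:
  fixes p :: "'a :: comm_ring_1 poly"
  assumes "s > 0"
  shows "\<exists>q. section_fps s t (fps_of_poly p) = fps_of_poly q"
proof
  have "Polynomial.coeff p (s * n + t) = 0" if "n > Polynomial.degree p" for n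
    using that assms by (intro coeff_eq_0) (simp add: less_le_trans trans_le_add1)
  then show "section_fps s t (fps_of_poly p) =
      fps_of_poly (truncate_fps (Suc (Polynomial.degree p)) (section_fps s t (fps_of_poly p)))"
    by (intro fps_ext) simp
qed

lemma section_fixed_denominator_dvd:
  fixes F :: "'a :: field_gcd fps"
  assumes "t < s" and fixed: "section_fps s t F = F"
    and rational: "F * fps_of_poly Q = fps_of_poly P" and "coprime P Q"
    and dvd: "Q dvd G \<circ>\<^sub>p Polynomial.monom 1 s"
  shows "Q dvd G"
proof -
  obtain N where N: "G \<circ>\<^sub>p Polynomial.monom 1 s = Q * N" using dvd by blast
  have "(fps_of_poly G oo fps_X ^ s) * F = fps_of_poly (G \<circ>\<^sub>p Polynomial.monom 1 s) * F"
    using \<open>t < s\<close> by (simp add: fps_of_poly_pcompose fps_of_poly_monom')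
  also have "\<dots> = fps_of_poly (P * N)"
    by (simp add: N fps_of_poly_mult rational[symmetric] mult_ac)
  finally have "fps_of_poly G * F = section_fps s t (fps_of_poly (P * N))"
    using section_fps_mult_compose_X_power[OF \<open>t < s\<close>, of "fps_of_poly G" F] fixed by simp
  then obtain M where M: "fps_of_poly G * F = fps_of_poly M"
    using section_fps_of_poly[of s t "P * N"] \<open>t < s\<close> by auto
  have "fps_of_poly (P * G) = fps_of_poly (M * Q)"
    by (simp add: fps_of_poly_mult M[symmetric] rational[symmetric] mult_ac)
  then have "Q dvd P * G" by (simp add: fps_of_poly_eq_iff)
  then show ?thesis using \<open>coprime P Q\<close> by (simp add: coprime_commute coprime_dvd_mult_right_iff)
qed

lemma pcompose_power: "(p ^ n) \<circ>\<^sub>p q = (p \<circ>\<^sub>p q) ^ n" for p q :: "'a :: comm_ring_1 poly"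
  by (induction n) (simp_all add: pcompose_mult pcompose_1)

lemma section_fixed_roots_subset_power_image:
  fixes F :: "complex fps"
  assumes "t < s" "section_fps s t F = F" "F * fps_of_poly Q = fps_of_poly P" "coprime P Q"
    and "Q \<noteq> 0"
  shows "{z. poly Q z = 0} \<subseteq> (\<lambda>z. z ^ s) ` {z. poly Q z = 0}"
proof -
  define Z where "Z = {z. poly Q z = 0}"
  define A where "A = (\<Prod>z\<in>Z. [:- (z ^ s), 1:])"
  have "finite Z" unfolding Z_def by (rule poly_roots_finite[OF \<open>Q \<noteq> 0\<close>])
  then have A_roots: "poly A x = 0 \<longleftrightarrow> x \<in> (\<lambda>z. z ^ s) ` Z" for x
    by (auto simp: A_def poly_prod)
  then have "\<forall>z. poly Q z = 0 \<longrightarrow> poly (A \<circ>\<^sub>p Polynomial.monom 1 s) z = 0"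
    by (auto simp: poly_pcompose poly_monom Z_def)
  then have "Q dvd (A ^ Polynomial.degree Q) \<circ>\<^sub>p Polynomial.monom 1 s"
    unfolding nullstellensatz_univariate pcompose_power using \<open>Q \<noteq> 0\<close> by simp
  then have "Q dvd A ^ Polynomial.degree Q"
    by (rule section_fixed_denominator_dvd[OF assms(1-4)])
  then have "\<forall>z. poly Q z = 0 \<longrightarrow> poly A z = 0"
    unfolding nullstellensatz_univariate by blast
  then show ?thesis using A_roots by (auto simp: Z_def)
qed

lemma roots_of_unity_if_subset_power_image:
  fixes Z :: "'a :: idom set"
  assumes "finite Z" "0 \<notin> Z" and Z: "Z \<subseteq> (\<lambda>z. z ^ s) ` Z" and "s \<ge> 2"
  obtains d where "d > 0" "coprime d s" "\<And>z. z \<in> Z \<Longrightarrow> z ^ d = 1"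
proof -
  have "(\<lambda>z. z ^ s) ` Z = Z"
    using \<open>finite Z\<close> Z by (metis card_image_le card_seteq finite_imageI)
  then have "bij_betw (\<lambda>z. z ^ s) Z Z"
    using \<open>finite Z\<close> by (simp add: bij_betw_def eq_card_imp_inj_on)
  then obtain m where m: "m > 0" "\<And>z. z \<in> Z \<Longrightarrow> ((\<lambda>z. z ^ s) ^^ m) z = z"
    using finite_bij_betw_funpow_eq_self[OF \<open>finite Z\<close>] by metis
  have funpow: "((\<lambda>z. z ^ s) ^^ k) z = z ^ (s ^ k)" for k and z :: 'a
    by (induction k) (simp_all add: power_mult[symmetric] mult.commute)
  obtain d where d: "s ^ m = Suc d" "d > 0"
    using one_less_power[of s m] m(1) \<open>s \<ge> 2\<close> by (cases "s ^ m") auto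
  show ?thesis
  proof
    show "d > 0" by fact
    have "coprime d (s ^ m)" by (simp add: d)
    then show "coprime d s" using m(1) by simp
    fix z assume "z \<in> Z"
    then have "z * z ^ d = z" "z \<noteq> 0" using m(2) \<open>0 \<notin> Z\<close> by (auto simp: funpow d)
    then show "z ^ d = 1" by simp
  qed
qed

lemma rational_fps_if_denominator_roots_of_unity:
  fixes F :: "complex fps"
  assumes "F * fps_of_poly Q = fps_of_poly P" "Q \<noteq> 0" "\<And>z. poly Q z = 0 \<Longrightarrow> z ^ r = 1"
  obtains k p where "F * (1 - fps_X ^ r) ^ k = fps_of_poly p"
proof -
  have "\<forall>z. poly Q z = 0 \<longrightarrow> poly (1 - Polynomial.monom 1 r) z = 0"
    using assms(3) by (simp add: poly_monom)
  then have "Q dvd (1 - Polynomial.monom 1 r) ^ Polynomial.degree Q"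
    unfolding nullstellensatz_univariate using \<open>Q \<noteq> 0\<close> by simp
  then obtain N where N: "(1 - Polynomial.monom 1 r) ^ Polynomial.degree Q = Q * N" by blast
  have "F * (1 - fps_X ^ r) ^ Polynomial.degree Q = F * fps_of_poly (Q * N)"
    by (simp add: fps_of_poly_power fps_of_poly_diff fps_of_poly_monom' flip: N)
  also have "\<dots> = fps_of_poly (P * N)"
    by (simp add: fps_of_poly_mult mult.assoc[symmetric] assms(1))
  finally show ?thesis by (rule that)
qed

lemma affine_invariant_recurrent:
  fixes s t :: nat
  assumes "\<And>n. f (s * n + t) = f n" "s > 0" "t > 0"
  shows "\<exists>h>0. f (n + h * (\<Sum>i<k. s ^ i)) = f n"
proof (intro exI conjI)
  have "s ^ k \<ge> 1" using \<open>s > 0\<close> by simp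
  then have "s ^ k = 1 + (s - 1) * (\<Sum>i<k. s ^ i)"
    by (subst power_diff_1_eq_nat[symmetric]) simp
  then have "n + ((s - 1) * n + t) * (\<Sum>i<k. s ^ i) = ((\<lambda>n. s * n + t) ^^ k) n"
    by (simp only: funpow_affine) (simp add: algebra_simps)
  then show "f (n + ((s - 1) * n + t) * (\<Sum>i<k. s ^ i)) = f n"
    using invariant_funpow[of f "\<lambda>n. s * n + t"] assms(1) by simp
  show "(s - 1) * n + t > 0" using \<open>t > 0\<close> by simp
qed

lemma section_fixed_rational_fps_periodic:
  fixes F :: "complex fps"
  assumes s: "s \<ge> 2" and t: "t > 0" "t < s" and fixed: "section_fps s t F = F"
    and rational: "F * fps_of_poly Q = fps_of_poly P" and "coprime P Q" "poly Q 0 \<noteq> 0"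
  obtains k where "k \<ge> 2" "\<And>n. fps_nth F (n + (\<Sum>i<k. s ^ i)) = fps_nth F n"
proof -
  have "Q \<noteq> 0" using \<open>poly Q 0 \<noteq> 0\<close> by auto
  have "{z. poly Q z = 0} \<subseteq> (\<lambda>z. z ^ s) ` {z. poly Q z = 0}"
    using t(2) fixed rational \<open>coprime P Q\<close> \<open>Q \<noteq> 0\<close>
    by (rule section_fixed_roots_subset_power_image)
  then obtain d where d: "d > 0" "coprime d s" "\<And>z. poly Q z = 0 \<Longrightarrow> z ^ d = 1"
    using roots_of_unity_if_subset_power_image[OF poly_roots_finite[OF \<open>Q \<noteq> 0\<close>]] s \<open>poly Q 0 \<noteq> 0\<close>
    by auto
  obtain k where k: "k \<ge> 2" "d dvd (\<Sum>i<k. s ^ i)"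
    using ex_dvd_geometric_sum d(1,2) s by blast
  have "z ^ (\<Sum>i<k. s ^ i) = 1" if "poly Q z = 0" for z
    using k(2) d(3)[OF that] by (auto simp: power_mult elim!: dvdE)
  then obtain l p where "F * (1 - fps_X ^ (\<Sum>i<k. s ^ i)) ^ l = fps_of_poly p"
    using rational_fps_if_denominator_roots_of_unity[OF rational \<open>Q \<noteq> 0\<close>] by blast
  moreover have "(\<Sum>i<k. s ^ i) > 0"
    using k(1) s by (intro sum_pos) (auto simp: lessThan_empty_iff)
  moreover have "fps_nth F (s * n + t) = fps_nth F n" for n
    using fixed by (metis section_fps_nth)
  then have "\<exists>h>0. fps_nth F (n + h * (\<Sum>i<k. s ^ i)) = fps_nth F n" for n
    using s t(1) by (intro affine_invariant_recurrent) auto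
  ultimately have "fps_nth F (n + (\<Sum>i<k. s ^ i)) = fps_nth F n" for n
    by (rule rational_fps_periodic_if_recurrent)
  with k(1) show ?thesis by (rule that)
qed

subsection \<open>Laurent expansions of rational functions\<close>

lemma laurent_add: "laurent (R + S) = laurent R + laurent S"
proof -
  obtain a b where R: "R = Fract a b" "b \<noteq> 0" by (cases R)
  obtain c d where S: "S = Fract c d" "d \<noteq> 0" by (cases S)
  show ?thesis using R S
    by (simp add: laurent_Fract fps_of_poly_add fps_of_poly_mult fls_times_fps_to_fls
          add_frac_eq mult_ac)
qed

lemma laurent_scale: "laurent (scale_ratfun c R) = fls_const c * laurent R"
proof -
  obtain a b where "R = Fract a b" "b \<noteq> 0" by (cases R)
  then show ?thesis
    by (simp add: scale_ratfun_def to_fract_def laurent_Fract fps_of_poly_smult fls_times_fps_to_fls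
          fps_of_poly_const)
qed

lemma laurent_eq_0_iff: "laurent R = 0 \<longleftrightarrow> R = 0"
proof -
  obtain a b where "R = Fract a b" "b \<noteq> 0" by (cases R)
  then show ?thesis by (simp add: laurent_Fract Zero_fract_def eq_fract)
qed

lemma laurent_0 [simp]: "laurent 0 = 0"
  by (simp add: laurent_eq_0_iff)

lemma laurent_eq_iff: "laurent R = laurent S \<longleftrightarrow> R = S"
proof -
  have "laurent R = laurent (R - S) + laurent S" by (simp flip: laurent_add)
  then show ?thesis using laurent_eq_0_iff[of "R - S"] by simp
qed

lemma laurent_sum: "laurent (\<Sum>i\<in>I. R i) = (\<Sum>i\<in>I. laurent (R i))"
  by (induction I rule: infinite_finite_induct) (simp_all add: laurent_add)

lemma fixed_by_phi_iff:
  "fixed_by_phi s t R \<longleftrightarrow> (\<forall>n. fls_nth (laurent R) (s * n + t) = fls_nth (laurent R) n)"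
  by (simp add: fixed_by_phi_def phi_def fun_eq_iff)

lemma subspace_fixed_by_phi: "ratfun.subspace {R. fixed_by_phi s t R}"
  by (rule ratfun.subspaceI) (simp_all add: fixed_by_phi_iff laurent_add laurent_scale)

lemma laurent_periodic_fraction:
  assumes "r > 0" "S \<subseteq> {0..<r}"
  shows "fls_nth (laurent
      (Fract (\<Sum>j\<in>S. Polynomial.monom (c j) (nat j)) (1 - Polynomial.monom 1 (nat r)))) n =
    (if n \<ge> 0 \<and> n mod r \<in> S then c (n mod r) else 0)"
proof -
  let ?P = "\<Sum>j\<in>S. Polynomial.monom (c j) (nat j)"
  let ?Q = "1 - Polynomial.monom 1 (nat r) :: complex poly"
  define F where "F = Abs_fps (\<lambda>k. if int k mod r \<in> S then c (int k mod r) else 0)"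
  have "finite S" using assms(2) by (rule finite_subset) simp
  have "Polynomial.coeff ?P k = (if int k \<in> S then c (int k) else 0)" for k
  proof -
    have "Polynomial.coeff ?P k = (\<Sum>j\<in>S. if j = int k then c j else 0)"
      unfolding coeff_sum using assms(2) by (intro sum.cong) auto
    then show ?thesis using \<open>finite S\<close> by simp
  qed
  moreover have "int k \<notin> S" if "k \<ge> nat r" for k
    using that assms(2) by auto
  moreover have "int (k - nat r) mod r = int k mod r" if "k \<ge> nat r" for k
    using that assms(1) by (simp add: of_nat_diff)
  ultimately have "F * fps_of_poly ?Q = fps_of_poly ?P"
    using assms(1) by (intro fps_ext)
       (auto simp: F_def fps_of_poly_diff fps_of_poly_monom' right_diff_distrib
          fps_X_power_mult_right_nth)
  then have "poly_to_fls ?P = fps_to_fls F * poly_to_fls ?Q"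
    by (simp flip: fls_times_fps_to_fls)
  moreover have "Polynomial.coeff ?Q 0 = 1" using assms(1) by simp
  then have "?Q \<noteq> 0" by (metis coeff_0 zero_neq_one)
  ultimately have "laurent (Fract ?P ?Q) = fps_to_fls F"
    by (simp add: laurent_Fract)
  then show ?thesis by (simp add: F_def)
qed

subsection \<open>Rational functions fixed by \<open>\<phi>\<close>\<close>

lemma affine_less_self_if_neg:
  fixes s t n :: int
  assumes "s \<ge> 2" "t \<le> s - 2" "n < 0"
  shows "s * n + t < n"
proof -
  have "(s - 1) * n \<le> (s - 1) * (-1)" using assms by (intro mult_left_mono) auto
  then show ?thesis using assms by (simp add: algebra_simps)
qed

lemma affine_nonneg_iff:
  fixes s t n :: int
  assumes "s \<ge> 2" "0 \<le> t" "t \<le> s - 2"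
  shows "s * n + t \<ge> 0 \<longleftrightarrow> n \<ge> 0"
  using affine_less_self_if_neg[of s t n] assms by (cases "n \<ge> 0") auto

lemma fixed_by_phi_nth_neg:
  assumes s: "s \<ge> 2" and t: "t \<le> s - 2" and fixed: "fixed_by_phi s t R" and "n < 0"
  shows "fls_nth (laurent R) n = 0"
  using \<open>n < 0\<close>
proof (induction "nat (n + 1 - fls_subdegree (laurent R))" arbitrary: n rule: less_induct)
  case less
  show ?case
  proof (cases "n < fls_subdegree (laurent R)")
    case False
    then have "fls_nth (laurent R) (s * n + t) = 0"
      using affine_less_self_if_neg[OF s t less.prems] less.prems by (intro less.hyps) auto
    then show ?thesis using fixed by (simp add: fixed_by_phi_iff)
  qed simp
qed

lemma laurent_nonneg_rational_fps:
  assumes "\<And>n. n < 0 \<Longrightarrow> fls_nth (laurent R) n = 0"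
  obtains F P Q where "laurent R = fps_to_fls F" "F * fps_of_poly Q = fps_of_poly P"
    "coprime P Q" "poly Q 0 \<noteq> 0"
proof -
  define P Q F where "P = fst (quot_of_fract R)" and "Q = snd (quot_of_fract R)"
    and "F = fls_regpart (laurent R)"
  have "Q \<noteq> 0" "coprime P Q" "R = Fract P Q"
    by (simp_all add: P_def Q_def coprime_quot_of_fract Fract_quot_of_fract)
  have F: "laurent R = fps_to_fls F"
    using assms by (intro fls_eqI) (auto simp: F_def)
  then have "fps_to_fls (F * fps_of_poly Q) = fps_to_fls (fps_of_poly P)"
    using \<open>Q \<noteq> 0\<close> by (simp add: fls_times_fps_to_fls \<open>R = _\<close> laurent_Fract field_simps flip: F)
  then have FQ: "F * fps_of_poly Q = fps_of_poly P" by (simp only: fps_to_fls_eq_iff)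
  then have "poly P 0 = fps_nth F 0 * poly Q 0"
    by (metis fps_mult_nth_0 fps_of_poly_nth poly_0_coeff_0)
  then have "poly Q 0 \<noteq> 0" using coprime_poly_0[OF \<open>coprime P Q\<close>, of 0] by auto
  with F FQ \<open>coprime P Q\<close> show ?thesis by (rule that)
qed

lemma fixed_by_phi_periodic:
  assumes s: "s \<ge> 2" and t: "1 \<le> t" "t \<le> s - 2" and fixed: "fixed_by_phi s t R"
  obtains r where "distinguished s t r"
    "\<And>n. n \<ge> 0 \<Longrightarrow> fls_nth (laurent R) (n mod r) = fls_nth (laurent R) n"
proof -
  obtain F P Q where F: "laurent R = fps_to_fls F"
    and PQ: "F * fps_of_poly Q = fps_of_poly P" "coprime P Q" "poly Q 0 \<noteq> 0"
    using laurent_nonneg_rational_fps fixed_by_phi_nth_neg[OF s t(2) fixed] by metis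
  obtain s' t' where st: "s = int s'" "t = int t'"
    using s t(1) by (metis nonneg_int_cases order_trans zero_le_numeral zero_le_one)
  have "fps_nth F (s' * n + t') = fps_nth F n" for n
    using fixed[unfolded fixed_by_phi_iff, rule_format, of "int n"]
    by (simp add: F st flip: of_nat_mult of_nat_add)
  then have "section_fps s' t' F = F" by (intro fps_ext) simp
  then obtain k where k: "k \<ge> 2" "\<And>n. fps_nth F (n + (\<Sum>i<k. s' ^ i)) = fps_nth F n"
    using section_fixed_rational_fps_periodic[of s' t' F Q P] s t PQ by (auto simp: st)
  show ?thesis
  proof
    show "distinguished s t (\<Sum>i<k. s ^ i)" using s k(1) by (rule distinguished_geometric_sum)
    fix n :: int assume "n \<ge> 0"
    then obtain m where "n = int m" by (rule nonneg_int_cases)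
    then have "n mod (\<Sum>i<k. s ^ i) = int (m mod (\<Sum>i<k. s' ^ i))"
      by (simp add: st zmod_int)
    with \<open>n = int m\<close> show "fls_nth (laurent R) (n mod (\<Sum>i<k. s ^ i)) = fls_nth (laurent R) n"
      using nat_periodic_mod[of "fps_nth F", OF k(2)] by (simp add: F)
  qed
qed

subsection \<open>Orbits modulo \<open>r\<close>\<close>

lemma self_in_orbit_set: "n \<in> orbit_set s t r n"
  by (auto simp: orbit_set_def rho_iter_def intro: exI[of _ 0])

lemma rho_mod: "rho s t r (n mod r) = (s * n + t) mod r"
  unfolding rho_def by (metis mod_add_left_eq mod_mult_right_eq)

context
  fixes s t r :: int
  assumes r: "r \<ge> 1" and coprime: "coprime r s"
begin

lemma orbit_set_eq_orbit:
  assumes "n \<in> {0..<r}"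
  shows "orbit_set s t r n = orbit (rho s t r) n"
proof
  have bij: "bij_betw (rho s t r) {0..<r} {0..<r}" using r coprime by (rule bij_betw_rho)
  have backward: "(inv_into {0..<r} (rho s t r) ^^ k) n \<in> orbit (rho s t r) n" for k
    using bij assms by (intro inv_into_funpow_in_orbit) auto
  then have "(rho s t r ^^ k) n \<in> orbit (rho s t r) n" for k
    using funpow_in_orbit[of n "rho s t r" n k] backward[of 0] by simp
  with backward show "orbit_set s t r n \<subseteq> orbit (rho s t r) n"
    by (auto simp: orbit_set_def rho_iter_def)
  have "(rho s t r ^^ k) n = rho_iter s t r (int k) n" for k by (simp add: rho_iter_def)
  then show "orbit (rho s t r) n \<subseteq> orbit_set s t r n"
    by (auto simp: orbit_altdef orbit_set_def)
qed

lemma orbit_set_subset: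
  assumes "n \<in> {0..<r}"
  shows "orbit_set s t r n \<subseteq> {0..<r}"
  unfolding orbit_set_eq_orbit[OF assms]
proof
  fix m assume "m \<in> orbit (rho s t r) n"
  then show "m \<in> {0..<r}" by induction (use r in \<open>auto simp: rho_def\<close>)
qed

lemma orbit_set_eq_iff:
  assumes "m \<in> {0..<r}" "n \<in> {0..<r}"
  shows "orbit_set s t r m = orbit_set s t r n \<longleftrightarrow> m \<in> orbit_set s t r n"
proof
  assume "orbit_set s t r m = orbit_set s t r n"
  then show "m \<in> orbit_set s t r n" using self_in_orbit_set[of m s t r] by simp
next
  assume "m \<in> orbit_set s t r n"
  then have m: "m \<in> orbit (rho s t r) n" using assms by (simp add: orbit_set_eq_orbit)
  have "n \<in> orbit (rho s t r) n"
    using self_in_orbit_set[of n s t r] assms by (simp add: orbit_set_eq_orbit)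
  then have "n \<in> orbit (rho s t r) m" using m by (rule orbit_swap)
  then have "orbit (rho s t r) m = orbit (rho s t r) n" using m by (blast intro: orbit_trans)
  then show "orbit_set s t r m = orbit_set s t r n" using assms by (simp add: orbit_set_eq_orbit)
qed

lemma rho_in_orbit_set_iff:
  assumes "m \<in> {0..<r}" "n \<in> {0..<r}"
  shows "rho s t r m \<in> orbit_set s t r n \<longleftrightarrow> m \<in> orbit_set s t r n"
proof -
  have range: "rho s t r m \<in> {0..<r}" using r by (simp add: rho_def)
  then have "orbit_set s t r (rho s t r m) = orbit_set s t r m"
    using self_in_orbit_set[of m s t r] assms(1) by (simp add: orbit_set_eq_orbit self_in_orbit_step)
  then show ?thesis using orbit_set_eq_iff range assms by metis
qed

lemma rho_invariant_eq_on_orbit_set: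
  assumes invariant: "\<And>m. m \<in> {0..<r} \<Longrightarrow> f (rho s t r m) = f m"
    and "n \<in> {0..<r}" "m \<in> orbit_set s t r n"
  shows "f m = f n"
proof -
  have "m \<in> orbit (rho s t r) n" using assms by (simp add: orbit_set_eq_orbit)
  then show ?thesis
  proof induction
    case base
    show ?case using \<open>n \<in> _\<close> by (rule invariant)
  next
    case (step m)
    then have "m \<in> {0..<r}" using orbit_set_subset[of n] orbit_set_eq_orbit \<open>n \<in> _\<close> by blast
    with step.IH show ?case by (simp add: invariant)
  qed
qed

lemma rho_invariant_eq_sum_orbit_reps:
  fixes f :: "int \<Rightarrow> 'a :: semiring_1"
  assumes reps: "orbit_reps s t r U" and "m \<in> {0..<r}"
    and invariant: "\<And>n. n \<in> {0..<r} \<Longrightarrow> f (rho s t r n) = f n"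
  shows "(\<Sum>n\<in>U. f n * of_bool (m \<in> orbit_set s t r n)) = f m"
proof -
  have U: "U \<subseteq> {0..<r}" using reps by (simp add: orbit_reps_def)
  then have "finite U" by (rule finite_subset) simp
  obtain u where u: "u \<in> U" "orbit_set s t r m = orbit_set s t r u"
    and unique: "\<And>n. n \<in> U \<Longrightarrow> orbit_set s t r m = orbit_set s t r n \<Longrightarrow> n = u"
    using reps \<open>m \<in> _\<close> unfolding orbit_reps_def by metis
  have "m \<in> orbit_set s t r n \<longleftrightarrow> n = u" if "n \<in> U" for n
    using orbit_set_eq_iff \<open>m \<in> _\<close> that U u unique by blast
  then have "(\<Sum>n\<in>U. f n * of_bool (m \<in> orbit_set s t r n)) =
      (\<Sum>n\<in>U. if n = u then f n else 0)"
    by (intro sum.cong) auto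
  also have "\<dots> = f u" using \<open>finite U\<close> \<open>u \<in> U\<close> by simp
  also have "f u = f m"
    using rho_invariant_eq_on_orbit_set[of f u m] invariant self_in_orbit_set[of m s t r] u U by auto
  finally show ?thesis .
qed

lemma laurent_orbit_fun:
  assumes "n \<in> {0..<r}"
  shows "fls_nth (laurent (orbit_fun s t r n)) k = of_bool (k \<ge> 0 \<and> k mod r \<in> orbit_set s t r n)"
  unfolding orbit_fun_def using r orbit_set_subset[OF assms]
  by (subst laurent_periodic_fraction) auto

lemma fixed_by_phi_orbit_fun:
  assumes "s \<ge> 2" "0 \<le> t" "t \<le> s - 2" "n \<in> {0..<r}"
  shows "fixed_by_phi s t (orbit_fun s t r n)"
proof -
  have "(s * k + t) mod r \<in> orbit_set s t r n \<longleftrightarrow> k mod r \<in> orbit_set s t r n" for k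
    using rho_in_orbit_set_iff[of "k mod r" n] r assms(4) by (simp add: rho_mod)
  then show ?thesis
    using affine_nonneg_iff[OF assms(1-3)] assms(4)
    by (simp add: fixed_by_phi_iff laurent_orbit_fun)
qed

lemma fixed_by_phi_eq_sum_orbit_fun:
  assumes "s \<ge> 2" "0 \<le> t" "t \<le> s - 2" and fixed: "fixed_by_phi s t R"
    and periodic: "\<And>n. n \<ge> 0 \<Longrightarrow> fls_nth (laurent R) (n mod r) = fls_nth (laurent R) n"
    and reps: "orbit_reps s t r U"
  shows "R = (\<Sum>n\<in>U. scale_ratfun (fls_nth (laurent R) n) (orbit_fun s t r n))"
proof -
  define a where "a = fls_nth (laurent R)"
  have U: "U \<subseteq> {0..<r}" using reps by (simp add: orbit_reps_def)
  have invariant: "a (rho s t r n) = a n" if "n \<in> {0..<r}" for n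
  proof -
    have "a (rho s t r n) = a (s * n + t)"
      using that assms(1,2) periodic unfolding a_def rho_def by simp
    also have "\<dots> = a n" using fixed by (simp add: fixed_by_phi_iff a_def)
    finally show ?thesis .
  qed
  have "laurent R = laurent (\<Sum>n\<in>U. scale_ratfun (a n) (orbit_fun s t r n))" (is "_ = ?S")
  proof (rule fls_eqI)
    fix k
    have S: "fls_nth ?S k = (\<Sum>n\<in>U. a n * of_bool (k \<ge> 0 \<and> k mod r \<in> orbit_set s t r n))"
      unfolding laurent_sum fls_nth_sum using U
      by (intro sum.cong) (auto simp: laurent_scale laurent_orbit_fun subset_iff)
    show "fls_nth (laurent R) k = fls_nth ?S k"
    proof (cases "k \<ge> 0")
      case True
      then have "fls_nth ?S k = a (k mod r)"
        using rho_invariant_eq_sum_orbit_reps[of U "k mod r" a] reps invariant r by (simp add: S)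
      then show ?thesis using True periodic by (simp add: a_def)
    next
      case False
      then show ?thesis using fixed_by_phi_nth_neg assms(1,3) fixed by (simp add: S)
    qed
  qed
  then show ?thesis by (simp add: laurent_eq_iff a_def)
qed

end

theorem theorem4p1:
  fixes s t :: int and Ups :: "int \<Rightarrow> int set"
  assumes "s \<ge> 2" and "1 \<le> t" and "t \<le> s - 2"
    and "\<And>r. distinguished s t r \<Longrightarrow> orbit_reps s t r (Ups r)"
  shows "ratfun.span {orbit_fun s t r n | r n. distinguished s t r \<and> n \<in> Ups r} =
    {R. fixed_by_phi s t R}"
proof
  let ?B = "{orbit_fun s t r n | r n. distinguished s t r \<and> n \<in> Ups r}"
  have r: "r \<ge> 1" "coprime r s" if "distinguished s t r" for r
    using that by (simp_all add: distinguished_def)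
  have "fixed_by_phi s t (orbit_fun s t r n)" if "distinguished s t r" "n \<in> Ups r" for r n
    using that assms(1-3) assms(4)[OF that(1)]
    by (intro fixed_by_phi_orbit_fun r) (auto simp: orbit_reps_def)
  then have "?B \<subseteq> {R. fixed_by_phi s t R}" by blast
  then show "ratfun.span ?B \<subseteq> {R. fixed_by_phi s t R}"
    by (rule ratfun.span_minimal) (rule subspace_fixed_by_phi)
  show "{R. fixed_by_phi s t R} \<subseteq> ratfun.span ?B"
  proof clarify
    fix R assume fixed: "fixed_by_phi s t R"
    obtain d where d: "distinguished s t d"
      "\<And>n. n \<ge> 0 \<Longrightarrow> fls_nth (laurent R) (n mod d) = fls_nth (laurent R) n"
      using fixed_by_phi_periodic[OF assms(1-3) fixed] by blast
    then have "R = (\<Sum>n\<in>Ups d. scale_ratfun (fls_nth (laurent R) n) (orbit_fun s t d n))"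
      using fixed_by_phi_eq_sum_orbit_fun[OF r] fixed assms by simp
    also have "\<dots> \<in> ratfun.span ?B"
      using d(1) by (intro ratfun.span_sum ratfun.span_scale ratfun.span_base) blast
    finally show "R \<in> ratfun.span ?B" .
  qed
qed

end
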